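(* Let $\mu>-1/2$ and let $c>1$. (i) There is a finite constant $\tau_e(c,\mu)$ such that for every $f_e\in\mathcal{B}^2_{e,\mu}$, $$E_{e,\mu}(f_e)\le c\,S_{L^2(\nu_{e,\mu})}(f_e)+\tau_e(c,\mu)\,\|f_e\|^2_{L^2(\nu_{e,\mu})}.$$ (ii) There is a finite constant $\tau_o(c,\mu)$ such that for every $f_o\in\mathcal{B}^2_{o,\mu}$, $$E_{o,\mu}(f_o)\le c\,S_{L^2(\nu_{o,\mu})}(f_o)+\tau_o(c,\mu)\,\|f_o\|^2_{L^2(\nu_{o,\mu})}.$$
   Context: Fix $\mu>-1/2$. For $x>0$ and $\alpha\in\mathbf{R}$, $K_\alpha(x)=\int_0^\infty e^{-x\cosh u}\cosh(\alpha u)\,du$ is the Macdonald function. On $\mathbf{C}$ define the finite measures $d\nu_{e,\mu}(z)=\nu_{e,\mu}(z)\,dx\,dy$ and $d\nu_{o,\mu}(z)=\nu_{o,\mu}(z)\,dx\,dy$ with densities, for $z\neq0$, $$\nu_{e,\mu}(z)=\frac{2^{\frac12-\mu}}{\pi\Gamma(\mu+\frac12)}K_{\mu-\frac12}(|z|^2)|z|^{2\mu+1},\qquad \nu_{o,\mu}(z)=\frac{2^{\frac12-\mu}}{\pi\Gamma(\mu+\frac12)}K_{\mu+\frac12}(|z|^2)|z|^{2\mu+1}.$$ $\mathcal{B}^2_{e,\mu}$ is the space of even entire functions $\mathbf{C}\to\mathbf{C}$ in $L^2(\mathbf{C},\nu_{e,\mu})$; $\mathcal{B}^2_{o,\mu}$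 is the space of odd entire functions in $L^2(\mathbf{C},\nu_{o,\mu})$. Entropy: for a finite measure space $(\Omega,\nu)$ and $f\in L^2(\Omega,\nu)$, $S_{L^2(\Omega,\nu)}(f)=\int_\Omega|f|^2\log|f|^2\,d\nu-\|f\|^2_{L^2}\log\|f\|^2_{L^2}\in(-\infty,+\infty]$, with $0\log0=0$; here $\Omega=\mathbf{C}$. $\mu$-deformed energies: $E_{e,\mu}(g)=\int_{\mathbf{C}}|z|^2|g(z)|^2\,d\nu_{e,\mu}(z)$ for $g\in\mathcal{B}^2_{e,\mu}$ and $E_{o,\mu}(h)=\int_{\mathbf{C}}|z|^2|h(z)|^2\,d\nu_{o,\mu}(z)$ for $h\in\mathcal{B}^2_{o,\mu}$, with values in $[0,+\infty]$. *)

theory Defs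
  imports "HOL-Analysis.Analysis"
begin

definition macdonald_K :: "real \<Rightarrow> real \<Rightarrow> real" where
  "macdonald_K \<alpha> x = (LINT u:{0..}|lborel. exp (- x * cosh u) * cosh (\<alpha> * u))"

text \<open>
  The value of the densities at the origin is irrelevant: a single point is a null set of
  Lebesgue measure on the plane.
\<close>

definition nu_e_density :: "real \<Rightarrow> complex \<Rightarrow> real" where
  "nu_e_density \<mu> z = 2 powr (1/2 - \<mu>) / (pi * Gamma (\<mu> + 1/2))
     * macdonald_K (\<mu> - 1/2) ((cmod z)\<^sup>2) * cmod z powr (2 * \<mu> + 1)"

definition nu_o_density :: "real \<Rightarrow> complex \<Rightarrow> real" where
  "nu_o_density \<mu> z = 2 powr (1/2 - \<mu>) / (pi * Gamma (\<mu> + 1/2))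
     * macdonald_K (\<mu> + 1/2) ((cmod z)\<^sup>2) * cmod z powr (2 * \<mu> + 1)"

definition nu_e :: "real \<Rightarrow> complex measure" where
  "nu_e \<mu> = density lborel (\<lambda>z. ennreal (nu_e_density \<mu> z))"

definition nu_o :: "real \<Rightarrow> complex measure" where
  "nu_o \<mu> = density lborel (\<lambda>z. ennreal (nu_o_density \<mu> z))"

definition in_L2 :: "'a measure \<Rightarrow> ('a \<Rightarrow> complex) \<Rightarrow> bool" where
  "in_L2 M f \<longleftrightarrow> f \<in> borel_measurable M \<and> integrable M (\<lambda>z. (cmod (f z))\<^sup>2)"

definition norm_L2 :: "'a measure \<Rightarrow> ('a \<Rightarrow> complex) \<Rightarrow> real" where
  "norm_L2 M f = sqrt (LINT z|M. (cmod (f z))\<^sup>2)"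

definition B2_e :: "real \<Rightarrow> (complex \<Rightarrow> complex) set" where
  "B2_e \<mu> = {f. f holomorphic_on UNIV \<and> (\<forall>z. f (- z) = f z) \<and> in_L2 (nu_e \<mu>) f}"

definition B2_o :: "real \<Rightarrow> (complex \<Rightarrow> complex) set" where
  "B2_o \<mu> = {f. f holomorphic_on UNIV \<and> (\<forall>z. f (- z) = - f z) \<and> in_L2 (nu_o \<mu>) f}"

text \<open>
  The integral of a real function as the integral of its positive part minus that of its
  negative part; \<open>ennreal\<close> truncates negative arguments to 0. It is meaningful when one of
  the two parts has a finite integral.
\<close>

definition ext_integral :: "'a measure \<Rightarrow> ('a \<Rightarrow> real) \<Rightarrow> ereal" where
  "ext_integral M \<phi> =
     enn2ereal (\<integral>\<^sup>+z. ennreal (\<phi> z) \<partial>M) - enn2ereal (\<integral>\<^sup>+z. ennreal (- \<phi> z) \<partial>M)"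

text \<open>
  For a finite measure the negative part of the integrand below is at most \<open>exp (-1)\<close>, so
  the entropy lies in \<open>(-\<infinity>, \<infinity>]\<close>. The convention that 0 times the logarithm of 0 is 0
  holds automatically, as \<open>ln\<close> is total.
\<close>

definition entropy_L2 :: "'a measure \<Rightarrow> ('a \<Rightarrow> complex) \<Rightarrow> ereal" where
  "entropy_L2 M f =
     ext_integral M (\<lambda>z. (cmod (f z))\<^sup>2 * ln ((cmod (f z))\<^sup>2))
       - ereal ((norm_L2 M f)\<^sup>2 * ln ((norm_L2 M f)\<^sup>2))"

definition energy_e :: "real \<Rightarrow> (complex \<Rightarrow> complex) \<Rightarrow> ennreal" where
  "energy_e \<mu> g = (\<integral>\<^sup>+z. ennreal ((cmod z)\<^sup>2 * (cmod (g z))\<^sup>2) \<partial>nu_e \<mu>)"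

definition energy_o :: "real \<Rightarrow> (complex \<Rightarrow> complex) \<Rightarrow> ennreal" where
  "energy_o \<mu> h = (\<integral>\<^sup>+z. ennreal ((cmod z)\<^sup>2 * (cmod (h z))\<^sup>2) \<partial>nu_o \<mu>)"

end

theory Submission
  imports Defs "HOL-Probability.Distributions" "HOL-Real_Asymp.Real_Asymp"
begin

text \<open>
  Applying Young's inequality \<open>s t \<le> s ln s - s + exp t\<close> pointwise with
  \<open>s = |f|\<^sup>2 / \<parallel>f\<parallel>\<^sup>2\<close> and \<open>t = |z|\<^sup>2 / c\<close> and integrating
  bounds the energy by \<open>c\<close> times the entropy plus a multiple of \<open>\<parallel>f\<parallel>\<^sup>2\<close>, as soon as
  \<open>exp (|z|\<^sup>2 / c)\<close> is integrable. For a density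
  \<open>K\<^sub>\<alpha>(|z|\<^sup>2) |z|\<^sup>p\<close> one inserts the integral representation of \<open>K\<^sub>\<alpha>\<close>; by Tonelli
  and scaling of the Gaussian \<open>z\<close>-integral, this amounts to the convergence of
  \<open>\<integral> cosh (\<alpha> u) (cosh u - 1/c) powr (- p/2 - 1) du\<close> over \<open>u \<ge> 0\<close>, which holds
  for \<open>c > 1\<close> and \<open>|\<alpha>| < p/2 + 1\<close>.
\<close>

section \<open>Young's inequality and the energy-entropy bound on a general measure space\<close>

text \<open>This is \<open>1 + x \<le> exp x\<close> at \<open>x = t - ln s\<close>, multiplied by
  \<open>s\<close>; at \<open>s = 0\<close> the left-hand side and the terms in \<open>s\<close>
  vanish.\<close>

lemma young_mult_exp:
  fixes s t :: real
  assumes "0 \<le> s"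
  shows "s * t \<le> s * ln s - s + exp t"
proof (cases "s = 0")
  case False
  with assms have s: "s > 0" by simp
  have "s * (1 + (t - ln s)) \<le> s * exp (t - ln s)"
    using s by (intro mult_left_mono exp_ge_add_one_self) auto
  also have "\<dots> = exp t" using s by (simp add: exp_diff)
  finally show ?thesis by (simp add: algebra_simps)
qed simp

text \<open>The case \<open>t = -1\<close> of Young's inequality; it bounds the negative part of the
  entropy integrand.\<close>

lemma mult_ln_ge: "0 \<le> s \<Longrightarrow> - exp (-1) \<le> s * ln (s::real)"
  using young_mult_exp[of s "-1"] by (simp add: algebra_simps) 

lemma ext_integral_integrable:
  assumes "integrable M \<phi>"
  shows "ext_integral M \<phi> = ereal (LINT x|M. \<phi> x)"
proof -
  have "(\<integral>\<^sup>+x. ennreal (\<phi> x) \<partial>M) < \<infinity>" "(\<integral>\<^sup>+x. ennreal (- \<phi> x) \<partial>M) < \<infinity>"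
    using assms by (auto simp: real_integrable_def less_top)
  then show ?thesis
    unfolding ext_integral_def real_lebesgue_integral_def[OF assms]
    by (cases "\<integral>\<^sup>+x. ennreal (\<phi> x) \<partial>M"; cases "\<integral>\<^sup>+x. ennreal (- \<phi> x) \<partial>M")
       (auto simp: enn2ereal_ennreal)
qed

text \<open>Integrating Young's inequality for the normalised density \<open>|f|^2 / N\<close>, with
  \<open>N\<close> the squared norm, produces the entropy from the logarithmic term. The remaining
  terms \<open>- |f|^2 + N * exp (w / c)\<close> integrate to \<open>(Z - 1) * N\<close>, which
  explains the constant.\<close>

lemma energy_le_entropy:
  fixes w :: "'a \<Rightarrow> real" and f :: "'a \<Rightarrow> complex"
  assumes c: "c > 0" and w: "\<And>x. 0 \<le> w x" "w \<in> borel_measurable M"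
    and Z: "integrable M (\<lambda>x. exp (w x / c))"
    and f: "in_L2 M f"
  shows "enn2ereal (\<integral>\<^sup>+x. ennreal (w x * (cmod (f x))\<^sup>2) \<partial>M)
    \<le> ereal c * entropy_L2 M f
      + ereal (c * ((LINT x|M. exp (w x / c)) - 1) * (norm_L2 M f)\<^sup>2)"
proof -
  define F where "F x = (cmod (f x))\<^sup>2" for x
  define \<phi> where "\<phi> x = F x * ln (F x)" for x
  define N where "N = (LINT x|M. F x)"
  define Z where "Z = (LINT x|M. exp (w x / c))"
  note [measurable] = w(2)
  have fm[measurable]: "f \<in> borel_measurable M" and Fi: "integrable M F"
    using f by (auto simp: in_L2_def F_def[abs_def])
  have Fm[measurable]: "F \<in> borel_measurable M" unfolding F_def[abs_def] by measurable
  have \<phi>m[measurable]: "\<phi> \<in> borel_measurable M" unfolding \<phi>_def[abs_def] by measurable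
  have F0: "0 \<le> F x" for x by (simp add: F_def)
  have N0: "0 \<le> N" unfolding N_def by (simp add: F0)
  have norm: "(norm_L2 M f)\<^sup>2 = N"
    using N0 by (simp add: norm_L2_def N_def F_def)
  \<comment> \<open>The right-hand side of Young's inequality multiplied by \<open>c * N\<close>,
    with the quotients by \<open>N\<close> cleared so that the formula also makes sense for
    \<open>N = 0\<close>.\<close>
  define \<psi> where "\<psi> x = c * (\<phi> x - F x * ln N - F x + N * exp (w x / c))" for x
  have "AE x in M. F x = 0" if "N = 0"
    using that integral_nonneg_eq_0_iff_AE[OF Fi] F0 by (simp add: N_def)
  then have ineq: "AE x in M. w x * F x \<le> \<psi> x"
  proof (cases "N = 0")
    case True
    then show ?thesis using \<open>N = 0 \<Longrightarrow> AE x in M. F x = 0\<close> 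
      by (auto simp: \<psi>_def \<phi>_def elim!: eventually_mono)
  next
    case False
    then have N: "N > 0" using N0 by simp
    have "w x * F x \<le> \<psi> x" for x
    proof -
      have "(F x / N) * (w x / c) \<le> (F x / N) * ln (F x / N) - F x / N + exp (w x / c)"
        using F0 N by (intro young_mult_exp) auto
      then have "(c * N) * ((F x / N) * (w x / c))
          \<le> (c * N) * ((F x / N) * ln (F x / N) - F x / N + exp (w x / c))"
        using c N by (intro mult_left_mono) auto
      also have "(c * N) * ((F x / N) * (w x / c)) = w x * F x"
        using c N by simp
      also have "(c * N) * ((F x / N) * ln (F x / N) - F x / N + exp (w x / c))
          = c * (F x * ln (F x / N) - F x + N * exp (w x / c))"
        using N by (simp add: field_simps)
      also have "F x * ln (F x / N) = \<phi> x - F x * ln N"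
        using F0[of x] N by (cases "F x = 0") (auto simp: \<phi>_def ln_div algebra_simps)
      also have "c * (\<phi> x - F x * ln N - F x + N * exp (w x / c)) = \<psi> x"
        by (simp add: \<psi>_def)
      finally show ?thesis .
    qed
    then show ?thesis by simp
  qed
  \<comment> \<open>The measure is finite, because \<open>1 \<le> exp (w x / c)\<close>.\<close>
  have fin: "integrable M (\<lambda>x. 1::real)"
    by (rule Bochner_Integration.integrable_bound[OF Z]) (use w c in auto)
  have neg: "(\<integral>\<^sup>+x. ennreal (- \<phi> x) \<partial>M) < \<infinity>"
  proof -
    have "(\<integral>\<^sup>+x. ennreal (- \<phi> x) \<partial>M) \<le> (\<integral>\<^sup>+x. ennreal (exp (-1) * 1) \<partial>M)"
      using mult_ln_ge[OF F0] by (intro nn_integral_mono ennreal_leI) (simp add: \<phi>_def minus_le_iff)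
    also have "\<dots> < \<infinity>"
      using integrable_mult_right[OF fin, of "exp (-1)"] 
      by (subst nn_integral_eq_integral) auto
    finally show ?thesis .
  qed
  show ?thesis
  \<comment> \<open>If the positive part of \<open>\<phi>\<close> has infinite integral, the entropy
    is infinite and, as \<open>c > 0\<close>, the bound is trivial. Otherwise \<open>\<phi>\<close>
    is integrable and the computation takes place in the reals.\<close>
  proof (cases "(\<integral>\<^sup>+x. ennreal (\<phi> x) \<partial>M) = \<infinity>")
    case True
    have "ext_integral M \<phi> = \<infinity>"
      using neg unfolding ext_integral_def True
      by (cases "\<integral>\<^sup>+x. ennreal (- \<phi> x) \<partial>M") (auto simp: enn2ereal_ennreal)
    then have "entropy_L2 M f = \<infinity>"
      by (simp add: entropy_L2_def \<phi>_def[abs_def] F_def)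
    then show ?thesis using c by simp
  next
    case False
    then have \<phi>i: "integrable M \<phi>"
      using neg by (auto simp: real_integrable_def)
    have \<psi>i: "integrable M \<psi>" unfolding \<psi>_def[abs_def]
      by (intro integrable_mult_right Bochner_Integration.integrable_add Bochner_Integration.integrable_diff integrable_mult_left \<phi>i Fi Z)
    \<comment> \<open>Domination by \<open>\<psi>\<close> shows that finite entropy forces finite
      energy.\<close>
    have wi: "integrable M (\<lambda>x. w x * F x)"
      by (rule Bochner_Integration.integrable_bound[OF \<psi>i])
         (use ineq w F0 in \<open>auto simp: abs_mult elim!: eventually_mono\<close>)
    have "(LINT x|M. w x * F x) \<le> (LINT x|M. \<psi> x)"
      by (rule integral_mono_AE[OF wi \<psi>i ineq])
    also have "\<dots> = c * ((LINT x|M. \<phi> x) - N * ln N) + c * (Z - 1) * N"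
      unfolding \<psi>_def using \<phi>i Fi Z
      by (simp add: N_def[symmetric] Z_def[symmetric]) (simp add: algebra_simps)
    finally have *: "(LINT x|M. w x * F x) \<le> c * ((LINT x|M. \<phi> x) - N * ln N) + c * (Z - 1) * N" .
    have ent: "entropy_L2 M f = ereal ((LINT x|M. \<phi> x) - N * ln N)"
      using ext_integral_integrable[OF \<phi>i] unfolding entropy_L2_def norm
      by (simp add: \<phi>_def[abs_def] F_def)
    have en: "enn2ereal (\<integral>\<^sup>+x. ennreal (w x * (cmod (f x))\<^sup>2) \<partial>M) = ereal (LINT x|M. w x * F x)"
      unfolding F_def[symmetric] using w F0
      by (subst nn_integral_eq_integral[OF wi]) (auto simp: enn2ereal_ennreal)
    show ?thesis unfolding ent en norm Z_def[symmetric] using * by simp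
  qed
qed

section \<open>Gaussian integrals on Euclidean spaces\<close>

text \<open>The Gaussian factors over the coordinates into multiples of the standard normal
  density.\<close>

lemma nn_integral_gaussian_finite:
  "(\<integral>\<^sup>+x. ennreal (exp (- (norm x)\<^sup>2 / 2)) \<partial>(lborel :: 'a::euclidean_space measure)) < \<infinity>"
proof -
  have 1: "integrable lborel (\<lambda>x::real. exp (- x\<^sup>2 / 2))"
    using integrable_mult_right[OF integrable_normal_density[of 1 0], of "sqrt (2 * pi)"]
    by (simp add: normal_density_def)
  have "exp (- (norm x)\<^sup>2 / 2) = (\<Prod>b\<in>Basis. exp (- (x \<bullet> b)\<^sup>2 / 2))" for x :: 'a
    unfolding exp_sum[OF finite_Basis, symmetric] power2_norm_eq_inner
    by (subst euclidean_inner) (simp add: power2_eq_square sum_negf sum_divide_distrib)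
  then have "(\<integral>\<^sup>+x. ennreal (exp (- (norm x)\<^sup>2 / 2)) \<partial>(lborel :: 'a measure))
      = (\<integral>\<^sup>+x. (\<Prod>b\<in>Basis. ennreal (exp (- (x \<bullet> b)\<^sup>2 / 2))) \<partial>(lborel :: 'a measure))"
    by (simp add: prod_ennreal)
  also have "\<dots> = (\<Prod>b\<in>(Basis::'a set). \<integral>\<^sup>+x. ennreal (exp (- x\<^sup>2 / 2)) \<partial>lborel)"
    by (rule nn_integral_lborel_prod) auto
  also have "\<dots> < \<infinity>"
    using 1 by (subst nn_integral_eq_integral) (auto simp: prod_ennreal ennreal_power)
  finally show ?thesis .
qed

lemma nn_integral_norm_powr_gaussian_finite:
  assumes "p > 0"
  shows "(\<integral>\<^sup>+x. ennreal (norm x powr p * exp (- (norm x)\<^sup>2)) \<partial>(lborel :: 'a::euclidean_space measure)) < \<infinity>"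
proof -
  \<comment> \<open>Half of the Gaussian exponent absorbs the power:
    \<open>ln (r / p) \<le> r / p - 1\<close> gives \<open>p * ln r \<le> p * ln p + r\<close>, and
    \<open>r \<le> r^2 / 2 + 1 / 2\<close>.\<close>
  define C where "C = exp (p * ln p + 1 / 2)"
  have "C \<ge> 0" by (simp add: C_def)
  have bound: "r powr p * exp (- r\<^sup>2) \<le> C * exp (- r\<^sup>2 / 2)" if "r \<ge> 0" for r
  proof (cases "r = 0")
    case False
    then have r: "r > 0" using that by simp
    have "p * ln (r / p) \<le> p * (r / p - 1)"
      using assms r by (intro mult_left_mono ln_le_minus_one) auto
    then have "p * ln r \<le> p * ln p + r"
      using assms r by (simp add: ln_div algebra_simps)
    moreover have "r \<le> r\<^sup>2 / 2 + 1 / 2"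
      using zero_le_power2[of "r - 1"] by (simp add: power2_eq_square algebra_simps)
    ultimately have "p * ln r - r\<^sup>2 \<le> p * ln p + 1 / 2 - r\<^sup>2 / 2" by simp
    then show ?thesis
      using r by (simp add: C_def powr_def exp_add[symmetric])
  qed (simp add: C_def)
  have "(\<integral>\<^sup>+x. ennreal (norm x powr p * exp (- (norm x)\<^sup>2)) \<partial>(lborel :: 'a measure))
      \<le> (\<integral>\<^sup>+x. ennreal C * ennreal (exp (- (norm x)\<^sup>2 / 2)) \<partial>(lborel :: 'a measure))"
    by (intro nn_integral_mono) (use bound \<open>C \<ge> 0\<close> in \<open>simp add: ennreal_mult'[symmetric] ennreal_leI\<close>)
  also have "\<dots> = ennreal C * (\<integral>\<^sup>+x. ennreal (exp (- (norm x)\<^sup>2 / 2)) \<partial>(lborel :: 'a measure))"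
    by (rule nn_integral_cmult) simp
  also have "\<dots> < \<infinity>"
    using nn_integral_gaussian_finite[where 'a='a] by (simp add: ennreal_mult_less_top)
  finally show ?thesis .
qed

text \<open>Substitute \<open>s *\<^sub>R x\<close> for \<open>x\<close> with
  \<open>s = a powr (- 1 / 2)\<close>, so that \<open>a * s^2 = 1\<close>. The power contributes
  \<open>s powr p\<close> and the Jacobian \<open>s ^ DIM('a)\<close>.\<close>

lemma nn_integral_norm_powr_gaussian_scale:
  assumes "a > 0"
  shows "(\<integral>\<^sup>+x. ennreal (norm x powr p * exp (- a * (norm x)\<^sup>2)) \<partial>(lborel :: 'a::euclidean_space measure))
    = ennreal (a powr (- (p + DIM('a)) / 2))
      * (\<integral>\<^sup>+x. ennreal (norm x powr p * exp (- (norm x)\<^sup>2)) \<partial>(lborel :: 'a measure))"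
proof -
  define s where "s = a powr (- 1 / 2)"
  have s: "s > 0" using assms by (simp add: s_def)
  have "s\<^sup>2 = inverse a"
    unfolding s_def power2_eq_square powr_add[symmetric] using assms by (simp add: powr_minus)
  then have sa: "a * s\<^sup>2 = 1" using assms by simp
  have sp: "s powr p * s ^ DIM('a) = a powr (- (p + DIM('a)) / 2)"
    using assms by (simp add: s_def powr_powr powr_power powr_add[symmetric] add_divide_distrib diff_divide_distrib)
  let ?f = "\<lambda>x::'a. ennreal (norm x powr p * exp (- a * (norm x)\<^sup>2))"
  have "(\<integral>\<^sup>+x. ?f x \<partial>lborel) = (\<integral>\<^sup>+x. ennreal (s ^ DIM('a)) * ?f (s *\<^sub>R x) \<partial>lborel)"
    using s by (subst lborel_affine[of s 0]) (simp_all add: nn_integral_density nn_integral_distr)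
  also have "\<dots> = (\<integral>\<^sup>+x. ennreal (a powr (- (p + DIM('a)) / 2))
      * ennreal (norm x powr p * exp (- (norm x)\<^sup>2)) \<partial>(lborel :: 'a measure))"
  proof (intro nn_integral_cong)
    fix x :: 'a
    have "a * (s * norm x)\<^sup>2 = (norm x)\<^sup>2"
      using sa by (simp add: power_mult_distrib mult.assoc[symmetric])
    then have "s ^ DIM('a) * (norm (s *\<^sub>R x) powr p * exp (- a * (norm (s *\<^sub>R x))\<^sup>2))
        = a powr (- (p + DIM('a)) / 2) * (norm x powr p * exp (- (norm x)\<^sup>2))"
      unfolding sp[symmetric] using s by (simp add: powr_mult)
    then show "ennreal (s ^ DIM('a)) * ?f (s *\<^sub>R x)
        = ennreal (a powr (- (p + DIM('a)) / 2)) * ennreal (norm x powr p * exp (- (norm x)\<^sup>2))"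
      using s by (simp add: ennreal_mult'[symmetric])
  qed
  finally show ?thesis by (simp add: nn_integral_cmult)
qed

section \<open>Convergence of the integral over the variable of the integral representation\<close>

text \<open>The numerator grows at most like \<open>exp (\<bar>\<alpha>\<bar> * u)\<close> and the
  power decays like \<open>exp (- q * u)\<close>, so the integrand decays at the positive rate
  \<open>q - \<bar>\<alpha>\<bar>\<close>.\<close>

lemma nn_integral_cosh_ratio_finite:
  assumes "\<bar>\<alpha>\<bar> < q" and "c > 1"
  shows "(\<integral>\<^sup>+u. ennreal (cosh (\<alpha> * u) * (cosh u - 1 / c) powr (- q)) * indicator {0..} u \<partial>lborel) < \<infinity>"
proof -
  \<comment> \<open>From \<open>cosh u \<ge> 1\<close> and \<open>cosh u \<ge> exp u / 2\<close> one
    gets \<open>cosh u - 1 / c \<ge> (1 - 1 / c) * cosh u \<ge> d * exp u\<close>; positivity of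
    \<open>d\<close> is the condition \<open>c > 1\<close>.\<close>
  define d where "d = (1 - 1 / c) / 2"
  have d: "d > 0" using assms by (simp add: d_def)
  have cosh_eq: "cosh x = (exp x + exp (- x)) / 2" for x :: real
    by (simp add: cosh_field_def)
  define b where "b = q - \<bar>\<alpha>\<bar>"
  have b: "b > 0" using assms by (simp add: b_def)
  have "cosh (\<alpha> * u) * (cosh u - 1 / c) powr (- q) \<le> d powr (- q) * exp (- b * u)" if u: "u \<ge> 0" for u
  proof -
    have "1 / c * 1 \<le> 1 / c * cosh u"
      using assms cosh_real_ge_1 by (intro mult_left_mono) auto
    then have "cosh u - 1 / c \<ge> (1 - 1 / c) * cosh u"
      by (simp add: algebra_simps)
    moreover have "(1 - 1 / c) * cosh u \<ge> (1 - 1 / c) * (exp u / 2)"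
      using assms by (intro mult_left_mono) (auto simp: cosh_eq)
    ultimately have "d * exp u \<le> cosh u - 1 / c" by (simp add: d_def)
    then have 1: "(cosh u - 1 / c) powr (- q) \<le> (d * exp u) powr (- q)"
      using d assms by (intro powr_mono2') auto
    have "exp (\<alpha> * u) \<le> exp (\<bar>\<alpha>\<bar> * u)" "exp (- (\<alpha> * u)) \<le> exp (\<bar>\<alpha>\<bar> * u)"
      using mult_right_mono[OF abs_ge_self u] mult_right_mono[OF abs_ge_minus_self[of \<alpha>] u] by auto
    from add_mono[OF this(1) this(2)] have "cosh (\<alpha> * u) \<le> exp (\<bar>\<alpha>\<bar> * u)"
      unfolding cosh_eq by simp
    then have "cosh (\<alpha> * u) * (cosh u - 1 / c) powr (- q) \<le> exp (\<bar>\<alpha>\<bar> * u) * (d * exp u) powr (- q)"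
      using 1 by (intro mult_mono) auto
    also have "\<dots> = d powr (- q) * exp (- b * u)"
      using d by (simp add: powr_mult exp_powr_real b_def exp_add[symmetric] algebra_simps)
    finally show ?thesis .
  qed
  then have "(\<integral>\<^sup>+u. ennreal (cosh (\<alpha> * u) * (cosh u - 1 / c) powr (- q)) * indicator {0..} u \<partial>lborel)
     \<le> (\<integral>\<^sup>+u. ennreal (d powr (- q) * exp (- b * u)) * indicator {0..} u \<partial>lborel)"
    by (intro nn_integral_mono) (auto split: split_indicator intro!: ennreal_leI)
  also have "\<dots> = ennreal (0 - (- (d powr (- q)) / b * exp (- b * 0)))"
  proof (rule nn_integral_FTC_atLeast)
    show "((\<lambda>u. - (d powr (- q)) / b * exp (- b * u)) \<longlongrightarrow> 0) at_top"
      using b by real_asymp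
  qed (use b in \<open>auto intro!: derivative_eq_intros\<close>)
  also have "\<dots> < \<infinity>" by simp
  finally show ?thesis .
qed

section \<open>Exponential moments of the Macdonald densities\<close>

text \<open>Without integrability the Bochner integral takes its default value 0, so the inequality
  survives.\<close>

lemma ennreal_integral_le_nn_integral:
  assumes "\<And>x. 0 \<le> f x"
  shows "ennreal (integral\<^sup>L M f) \<le> (\<integral>\<^sup>+x. ennreal (f x) \<partial>M)"
  using assms by (cases "integrable M f") (auto simp: nn_integral_eq_integral not_integrable_integral_eq)

lemma macdonald_K_nonneg: "0 \<le> macdonald_K \<alpha> x"
  unfolding macdonald_K_def set_lebesgue_integral_def
  by (intro Bochner_Integration.integral_nonneg) auto

text \<open>An upper bound suffices for proving finiteness, and it covers \<open>x = 0\<close>,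
  where the integral diverges and \<open>macdonald_K\<close> is 0 by default.\<close>

lemma macdonald_K_le:
  "ennreal (macdonald_K \<alpha> x)
    \<le> (\<integral>\<^sup>+u. ennreal (exp (- x * cosh u) * cosh (\<alpha> * u)) * indicator {0..} u \<partial>lborel)"
proof -
  have "ennreal (macdonald_K \<alpha> x)
      \<le> (\<integral>\<^sup>+u. ennreal (indicator {0..} u *\<^sub>R (exp (- x * cosh u) * cosh (\<alpha> * u))) \<partial>lborel)"
    unfolding macdonald_K_def set_lebesgue_integral_def
    by (rule ennreal_integral_le_nn_integral) simp
  also have "\<dots> = (\<integral>\<^sup>+u. ennreal (exp (- x * cosh u) * cosh (\<alpha> * u)) * indicator {0..} u \<partial>lborel)"
    by (intro nn_integral_cong) (simp split: split_indicator)
  finally show ?thesis .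
qed

lemma borel_measurable_cosh[measurable]: "(cosh :: real \<Rightarrow> real) \<in> borel_measurable borel"
  by (intro borel_measurable_continuous_onI continuous_intros)

lemma borel_measurable_macdonald_K[measurable]: "macdonald_K \<alpha> \<in> borel_measurable borel"
  unfolding macdonald_K_def[abs_def] set_lebesgue_integral_def by measurable

lemma macdonald_exp_moment_finite:
  assumes c: "c > 1" and p: "p > 0" and \<alpha>: "\<bar>\<alpha>\<bar> < p / 2 + 1" and k: "k \<ge> 0"
  shows "(\<integral>\<^sup>+z. ennreal (k * macdonald_K \<alpha> ((cmod z)\<^sup>2) * cmod z powr p)
            * ennreal (exp ((cmod z)\<^sup>2 / c)) \<partial>lborel) < \<infinity>"
proof -
  define G where "G = (\<integral>\<^sup>+z. ennreal (cmod z powr p * exp (- (cmod z)\<^sup>2)) \<partial>lborel)"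
  \<comment> \<open>The joint integrand: the factor \<open>exp ((cmod z)^2 / c)\<close> merges with
    \<open>exp (- (cmod z)^2 * cosh u)\<close> into a Gaussian of rate
    \<open>cosh u - 1 / c\<close>.\<close>
  define g where "g u z = ennreal (cosh (\<alpha> * u)) * indicator {0..} u
    * ennreal (cmod z powr p * exp (- (cosh u - 1 / c) * (cmod z)\<^sup>2))" for u :: real and z :: complex
  have [measurable]: "(\<lambda>(z, u). g u z) \<in> borel_measurable (lborel \<Otimes>\<^sub>M lborel)"
    unfolding g_def by measurable
  have [measurable]: "g u \<in> borel_measurable borel" "(\<lambda>u. g u z) \<in> borel_measurable borel" for u z
    unfolding g_def by measurable
  have G: "G < \<infinity>"
    using nn_integral_norm_powr_gaussian_finite[OF p, where 'a=complex] by (simp add: G_def)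
  have "(\<integral>\<^sup>+z. ennreal (k * macdonald_K \<alpha> ((cmod z)\<^sup>2) * cmod z powr p)
            * ennreal (exp ((cmod z)\<^sup>2 / c)) \<partial>lborel)
      \<le> (\<integral>\<^sup>+z. ennreal k * (\<integral>\<^sup>+u. g u z \<partial>lborel) \<partial>lborel)"
  proof (intro nn_integral_mono)
    fix z :: complex
    let ?m = "ennreal (cmod z powr p * exp ((cmod z)\<^sup>2 / c))"
    have "ennreal (k * macdonald_K \<alpha> ((cmod z)\<^sup>2) * cmod z powr p) * ennreal (exp ((cmod z)\<^sup>2 / c))
        = ennreal k * (?m * ennreal (macdonald_K \<alpha> ((cmod z)\<^sup>2)))"
      using k macdonald_K_nonneg[of \<alpha>] by (simp add: ennreal_mult'[symmetric] mult_ac)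
    also have "\<dots> \<le> ennreal k * (?m * (\<integral>\<^sup>+u. ennreal (exp (- (cmod z)\<^sup>2 * cosh u) * cosh (\<alpha> * u))
        * indicator {0..} u \<partial>lborel))"
      by (intro mult_left_mono macdonald_K_le) auto
    also have "?m * (\<integral>\<^sup>+u. ennreal (exp (- (cmod z)\<^sup>2 * cosh u) * cosh (\<alpha> * u)) * indicator {0..} u \<partial>lborel)
        = (\<integral>\<^sup>+u. ?m * (ennreal (exp (- (cmod z)\<^sup>2 * cosh u) * cosh (\<alpha> * u)) * indicator {0..} u) \<partial>lborel)"
      by (rule nn_integral_cmult[symmetric]) measurable
    also have "\<dots> = (\<integral>\<^sup>+u. g u z \<partial>lborel)"
      by (intro nn_integral_cong)
         (auto simp: g_def ennreal_mult'[symmetric] exp_add[symmetric] algebra_simps exp_diff exp_minus field_simps split: split_indicator)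
    finally show "ennreal (k * macdonald_K \<alpha> ((cmod z)\<^sup>2) * cmod z powr p) * ennreal (exp ((cmod z)\<^sup>2 / c))
        \<le> ennreal k * (\<integral>\<^sup>+u. g u z \<partial>lborel)" .
  qed
  also have "\<dots> = ennreal k * (\<integral>\<^sup>+z. (\<integral>\<^sup>+u. g u z \<partial>lborel) \<partial>lborel)"
    by (rule nn_integral_cmult) measurable
  also have "(\<integral>\<^sup>+z. (\<integral>\<^sup>+u. g u z \<partial>lborel) \<partial>lborel) = (\<integral>\<^sup>+u. (\<integral>\<^sup>+z. g u z \<partial>lborel) \<partial>lborel)"
    by (rule lborel_pair.Fubini'[symmetric]) measurable
  also have "\<dots> = (\<integral>\<^sup>+u. ennreal (cosh (\<alpha> * u) * (cosh u - 1 / c) powr (- (p / 2 + 1)))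
      * indicator {0..} u * G \<partial>lborel)"
  proof (intro nn_integral_cong)
    fix u :: real
    have "1 / c < 1" using c by simp
    then have pos: "cosh u - 1 / c > 0" using cosh_real_ge_1[of u] by linarith
    have "(\<integral>\<^sup>+z. g u z \<partial>lborel) = ennreal (cosh (\<alpha> * u)) * indicator {0..} u
        * (\<integral>\<^sup>+z. ennreal (cmod z powr p * exp (- (cosh u - 1 / c) * (cmod z)\<^sup>2)) \<partial>lborel)"
      unfolding g_def by (rule nn_integral_cmult) measurable
    also have "(\<integral>\<^sup>+z. ennreal (cmod z powr p * exp (- (cosh u - 1 / c) * (cmod z)\<^sup>2)) \<partial>lborel)
        = ennreal ((cosh u - 1 / c) powr (- (p / 2 + 1))) * G"
    proof -
      \<comment> \<open>The plane has real dimension 2, which is the origin of the exponent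
        \<open>p / 2 + 1\<close>.\<close>
      have "- (p + real DIM(complex)) / 2 = - (p / 2 + 1)" by simp
      then show ?thesis
        using nn_integral_norm_powr_gaussian_scale[OF pos, of p, where 'a=complex]
        by (simp only: G_def)
    qed
    finally show "(\<integral>\<^sup>+z. g u z \<partial>lborel)
        = ennreal (cosh (\<alpha> * u) * (cosh u - 1 / c) powr (- (p / 2 + 1))) * indicator {0..} u * G"
      by (simp add: ennreal_mult' mult_ac)
  qed
  also have "\<dots> = (\<integral>\<^sup>+u. ennreal (cosh (\<alpha> * u) * (cosh u - 1 / c) powr (- (p / 2 + 1)))
      * indicator {0..} u \<partial>lborel) * G"
    by (rule nn_integral_multc) measurable
  also have "ennreal k * \<dots> < \<infinity>"
    using nn_integral_cosh_ratio_finite[OF \<alpha> c] G by (simp add: ennreal_mult_less_top)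
  finally show ?thesis .
qed

section \<open>The energy-entropy inequality for Macdonald densities\<close>

text \<open>Covers the even and odd cases at once: \<open>p = 2 * \<mu> + 1\<close>, and \<alpha> is
  \<open>\<mu> - 1/2\<close> or \<open>\<mu> + 1/2\<close>. The constant \<tau> is
  \<open>c * (Z - 1)\<close> with \<open>Z\<close> the integral of
  \<open>exp ((cmod z)^2 / c)\<close> over \<open>M\<close>.\<close>

lemma energy_le_entropy_macdonald:
  fixes c p \<alpha> k :: real
  assumes c: "c > 1" and p: "p > 0" and \<alpha>: "\<bar>\<alpha>\<bar> < p / 2 + 1" and k: "k \<ge> 0"
  defines "M \<equiv> density lborel
    (\<lambda>z. ennreal (k * macdonald_K \<alpha> ((cmod z)\<^sup>2) * cmod z powr p))"
  shows "\<exists>\<tau>. \<forall>f. in_L2 M f \<longrightarrow>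
    enn2ereal (\<integral>\<^sup>+z. ennreal ((cmod z)\<^sup>2 * (cmod (f z))\<^sup>2) \<partial>M)
      \<le> ereal c * entropy_L2 M f + ereal (\<tau> * (norm_L2 M f)\<^sup>2)"
proof -
  have "integrable M (\<lambda>z. exp ((cmod z)\<^sup>2 / c))"
  proof (rule integrableI_bounded)
    show "(\<lambda>z. exp ((cmod z)\<^sup>2 / c)) \<in> borel_measurable M"
      by (simp add: M_def)
    show "(\<integral>\<^sup>+z. ennreal (norm (exp ((cmod z)\<^sup>2 / c))) \<partial>M) < \<infinity>"
      using macdonald_exp_moment_finite[OF c p \<alpha> k] by (simp add: M_def nn_integral_density)
  qed
  then have "enn2ereal (\<integral>\<^sup>+z. ennreal ((cmod z)\<^sup>2 * (cmod (f z))\<^sup>2) \<partial>M) \<le> ereal c * entropy_L2 M f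
      + ereal (c * ((LINT z|M. exp ((cmod z)\<^sup>2 / c)) - 1) * (norm_L2 M f)\<^sup>2)" if "in_L2 M f" for f
    using c that by (intro energy_le_entropy) (auto simp: M_def)
  then show ?thesis by blast
qed

theorem theorem4p4:
  fixes \<mu> c :: real
  assumes "\<mu> > - 1/2" and "c > 1"
  shows "(\<exists>\<tau>\<^sub>e::real. \<forall>f \<in> B2_e \<mu>.
            enn2ereal (energy_e \<mu> f)
              \<le> ereal c * entropy_L2 (nu_e \<mu>) f + ereal (\<tau>\<^sub>e * (norm_L2 (nu_e \<mu>) f)\<^sup>2))
       \<and> (\<exists>\<tau>\<^sub>o::real. \<forall>f \<in> B2_o \<mu>.
            enn2ereal (energy_o \<mu> f)
              \<le> ereal c * entropy_L2 (nu_o \<mu>) f + ereal (\<tau>\<^sub>o * (norm_L2 (nu_o \<mu>) f)\<^sup>2))"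
proof -
  \<comment> \<open>Here \<open>p / 2 + 1\<close> equals \<open>\<mu> + 3/2\<close>. The critical
    comparison is \<open>1/2 - \<mu> < \<mu> + 3/2\<close>, which is exactly
    \<open>\<mu> > - 1/2\<close>.\<close>
  have \<mu>: "2 * \<mu> + 1 > 0" "\<bar>\<mu> - 1/2\<bar> < (2 * \<mu> + 1) / 2 + 1" "\<bar>\<mu> + 1/2\<bar> < (2 * \<mu> + 1) / 2 + 1"
    using assms by (auto simp: abs_if field_simps)
  have k: "2 powr (1/2 - \<mu>) / (pi * Gamma (\<mu> + 1/2)) \<ge> 0"
    using assms Gamma_real_pos[of "\<mu> + 1/2"] by simp
  show ?thesis
    using energy_le_entropy_macdonald[OF assms(2) \<mu>(1,2) k]
      energy_le_entropy_macdonald[OF assms(2) \<mu>(1,3) k]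
    unfolding nu_e_def nu_o_def nu_e_density_def nu_o_density_def
      energy_e_def energy_o_def B2_e_def B2_o_def by blast
qed

end
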